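(* Let $S=(E,\mathcal A,\mu,T)$ be a dynamical system and $f:E\to[0,1]$ a measurable function, and let $\hat S_n$ be the centered dynamic random walk under the quenched measures $\mathbb P_x$, $x\in E$. Suppose that $f(1-f)\in\mathcal C_1(S)$ and that $a:=\int_E 4f(1-f)\,d\mu>0$. Let $(a_n)_{n\ge1}$ be an increasing sequence of positive reals such that $a_n/\sqrt n$ increases to $\infty$ and $a_n/n$ decreases to $0$. Then for every $x\in E$, $\frac1{a_n}\hat S_n$ obeys, under $\mathbb P_x$, a moderate deviation principle with speed $\frac{a_n^2}{n}$ and rate function $I(t)=\frac{t^2}{2a}$; that is, for every Borel set $B\subset\mathbb R$, with interior $B^\circ$ and closure $\overline B$, $$-\inf_{t\in B^\circ}I(t)\le\liminf_{n\to\infty}\frac{n}{a_n^2}\log\mathbb P_x\Big(\frac1{a_n}\hat S_n\in B\Big)\le\limsup_{n\to\infty}\frac{n}{a_n^2}\log\mathbb P_x\Big(\frac1{a_n}\hat S_n\in B\Big)\le-\inf_{t\in\overline B}I(t).$$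
   Context: A dynamical system $S=(E,\mathcal A,\mu,T)$ consists of a probability space $(E,\mathcal A,\mu)$ and a measurable, measure-preserving map $T:E\to E$. Given measurable $f:E\to[0,1]$ and $x\in E$, under $\mathbb P_x$ the random variables $X_1,X_2,\dots$ are independent with $\mathbb P_x(X_i=1)=f(T^ix)$ and $\mathbb P_x(X_i=-1)=1-f(T^ix)$. Set $\hat X_i=X_i-(2f(T^ix)-1)$ and $\hat S_n=\sum_{i=1}^n\hat X_i$. For $\alpha\in[0,1]$, $\mathcal C_\alpha(S)$ is the class of $\mu$-integrable functions $h:E\to\mathbb R$ such that $\left|\sum_{k=1}^n\big(h(T^kx)-\int_Eh\,d\mu\big)\right|=o(n^\alpha)$ as $n\to\infty$, for every $x\in E$. Conventions: $\log 0=-\infty$, $\inf\emptyset=+\infty$. *)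

theory Defs
  imports "HOL-Probability.Probability" "HOL-Library.Landau_Symbols"
begin

locale dynamical_system = prob_space M
  for M :: "'e measure" +
  fixes T :: "'e \<Rightarrow> 'e"
  assumes measurable_T: "T \<in> measurable M M"
    and measure_preserving_T: "\<And>A. A \<in> sets M \<Longrightarrow> emeasure M (T -` A \<inter> space M) = emeasure M A"

text \<open>
  The steps \<open>X i\<close>, \<open>i \<ge> 1\<close>, live on one measurable space \<open>W\<close>, which carries the whole family
  of quenched measures \<open>P x\<close>. No particular realization is singled out; only the law of the steps
  is prescribed. The value \<open>X 0\<close> is never used.
\<close>

locale dynamic_random_walk = dynamical_system M T
  for M :: "'e measure" and T :: "'e \<Rightarrow> 'e" +
  fixes f :: "'e \<Rightarrow> real"
    and W :: "'w measure"
    and P :: "'e \<Rightarrow> 'w measure"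
    and X :: "nat \<Rightarrow> 'w \<Rightarrow> real"
  assumes measurable_f: "f \<in> borel_measurable M"
    and f_range: "\<And>x. x \<in> space M \<Longrightarrow> f x \<in> {0..1}"
    and sets_P: "\<And>x. x \<in> space M \<Longrightarrow> sets (P x) = sets W"
    and prob_space_P: "\<And>x. x \<in> space M \<Longrightarrow> prob_space (P x)"
    and indep_steps: "\<And>x. x \<in> space M \<Longrightarrow> prob_space.indep_vars (P x) (\<lambda>_. borel) X {1..}"
    and prob_step_up: "\<And>x i. x \<in> space M \<Longrightarrow> i \<ge> 1 \<Longrightarrow>
      measure (P x) {\<omega> \<in> space (P x). X i \<omega> = 1} = f ((T ^^ i) x)"
    and prob_step_down: "\<And>x i. x \<in> space M \<Longrightarrow> i \<ge> 1 \<Longrightarrow>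
      measure (P x) {\<omega> \<in> space (P x). X i \<omega> = -1} = 1 - f ((T ^^ i) x)"

definition centered_step ::
  "('e \<Rightarrow> 'e) \<Rightarrow> ('e \<Rightarrow> real) \<Rightarrow> (nat \<Rightarrow> 'w \<Rightarrow> real) \<Rightarrow> 'e \<Rightarrow> nat \<Rightarrow> 'w \<Rightarrow> real" where
  "centered_step T f X x i \<omega> = X i \<omega> - (2 * f ((T ^^ i) x) - 1)"

definition centered_walk ::
  "('e \<Rightarrow> 'e) \<Rightarrow> ('e \<Rightarrow> real) \<Rightarrow> (nat \<Rightarrow> 'w \<Rightarrow> real) \<Rightarrow> 'e \<Rightarrow> nat \<Rightarrow> 'w \<Rightarrow> real" where
  "centered_walk T f X x n \<omega> = (\<Sum>i=1..n. centered_step T f X x i \<omega>)"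

text \<open>The bound is required at every point of the space, but not uniformly in the point.\<close>

definition class_C :: "real \<Rightarrow> 'e measure \<Rightarrow> ('e \<Rightarrow> 'e) \<Rightarrow> ('e \<Rightarrow> real) set" where
  "class_C \<alpha> M T = {h. integrable M h \<and>
     (\<forall>x\<in>space M. (\<lambda>n. \<bar>\<Sum>k=1..n. (h ((T ^^ k) x) - integral\<^sup>L M h)\<bar>) \<in> o(\<lambda>n. real n powr \<alpha>))}"

definition elog :: "real \<Rightarrow> ereal" where
  "elog p = (if p = 0 then -\<infinity> else ereal (ln p))"

text \<open>
  In \<open>ereal\<close> the infimum of the empty set is \<open>\<infinity>\<close>. The value of the speed \<open>v\<close> at \<open>0\<close> is irrelevant,
  as only limits along \<open>sequentially\<close> occur. A moderate deviation principle is this property for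
  \<open>Z n = S n / a n\<close> and \<open>v n = (a n)\<^sup>2 / n\<close>.
\<close>

definition deviation_principle ::
  "'w measure \<Rightarrow> (nat \<Rightarrow> 'w \<Rightarrow> real) \<Rightarrow> (nat \<Rightarrow> real) \<Rightarrow> (real \<Rightarrow> ereal) \<Rightarrow> bool" where
  "deviation_principle Q Z v I \<longleftrightarrow> (\<forall>B \<in> sets borel.
     (let L = (\<lambda>n. ereal (1 / v n) * elog (measure Q {\<omega> \<in> space Q. Z n \<omega> \<in> B}))
      in - (INF t\<in>interior B. I t) \<le> liminf L \<and> liminf L \<le> limsup L \<and>
         limsup L \<le> - (INF t\<in>closure B. I t)))"

end

theory Submission
  imports Defs
begin

text \<open>
  The log-Laplace transform of a centred \<open>\<plusminus>1\<close> step with success probability \<open>p\<close> is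
  \<open>2 \<lambda>\<^sup>2 p (1 - p) + O(\<bar>\<lambda>\<bar>\<^sup>3)\<close>, uniformly in \<open>p\<close>. At \<open>\<lambda> = s a\<^sub>n / n\<close> the sum over the steps,
  divided by the speed, is \<open>2 s\<^sup>2\<close> times the Birkhoff average of \<open>f (1 - f)\<close> up to
  \<open>O(\<bar>s\<bar>\<^sup>3 a\<^sub>n / n)\<close>, hence tends to \<open>A s\<^sup>2 / 2\<close>. A quadratic limit of this kind gives the deviation
  principle: the upper bound by Chernoff's inequality with slopes \<open>s\<close> and \<open>- s\<close>, the lower bound because
  the exponential moment with slope \<open>t / A\<close> is concentrated near \<open>t\<close>.
\<close>

section \<open>Exponential bounds on the logarithmic scale\<close>

lemma scaled_elog_le:
  assumes "v > 0" "0 \<le> p" "p \<le> exp (v * c)"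
  shows "ereal (1 / v) * elog p \<le> ereal c"
proof (cases "p = 0")
  case True
  then show ?thesis using assms by (simp add: elog_def)
next
  case False
  then have "p > 0" using assms by simp
  then have "ln p \<le> v * c"
    using assms ln_le_cancel_iff[of p "exp (v * c)"] by simp
  then show ?thesis using False assms by (simp add: elog_def field_simps)
qed

lemma scaled_elog_ge:
  assumes "v > 0" "exp (v * c) \<le> p"
  shows "ereal c \<le> ereal (1 / v) * elog p"
proof -
  have p: "p > 0" using assms(2) exp_gt_zero[of "v * c"] by linarith
  then have "v * c \<le> ln p"
    using assms ln_le_cancel_iff[of "exp (v * c)" p] by simp
  then show ?thesis using p assms by (simp add: elog_def field_simps)
qed

section \<open>A Gaertner-Ellis theorem on the real line for a quadratic limit\<close>

locale quadratic_mgf = prob_space Q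
  for Q :: "'w measure" +
  fixes Z :: "nat \<Rightarrow> 'w \<Rightarrow> real" and v :: "nat \<Rightarrow> real" and A :: real
  assumes A_pos: "A > 0"
    and measurable_Z [measurable]: "\<And>n. Z n \<in> borel_measurable Q"
    and integrable_exp: "\<And>n s. integrable Q (\<lambda>\<omega>. exp (s * Z n \<omega>))"
    and speed: "filterlim v at_top sequentially"
    and log_mgf_limit:
      "\<And>s. (\<lambda>n. ln (expectation (\<lambda>\<omega>. exp (v n * s * Z n \<omega>))) / v n) \<longlonglongrightarrow> A * s\<^sup>2 / 2"
begin

abbreviation mgf :: "nat \<Rightarrow> real \<Rightarrow> real" where
  "mgf n s \<equiv> expectation (\<lambda>\<omega>. exp (v n * s * Z n \<omega>))"

lemma mgf_pos: "mgf n s > 0"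
  by (rule expectation_greater) (auto intro: integrable_exp)

text \<open>Undoes the logarithm in \<open>log_mgf_limit\<close>, so that all later estimates only
  compare exponents of the form \<open>v n * c\<close>.\<close>

lemma eventually_mgf_bounds:
  assumes "\<eta> > 0"
  shows "\<forall>\<^sub>F n in sequentially.
    exp (v n * (A * s\<^sup>2 / 2 - \<eta>)) \<le> mgf n s \<and> mgf n s \<le> exp (v n * (A * s\<^sup>2 / 2 + \<eta>))"
proof -
  have "\<forall>\<^sub>F n in sequentially. dist (ln (mgf n s) / v n) (A * s\<^sup>2 / 2) < \<eta>"
    using log_mgf_limit[of s] assms by (rule tendstoD)
  moreover have "\<forall>\<^sub>F n in sequentially. v n > 0"
    using speed by (simp add: filterlim_at_top_dense)
  ultimately show ?thesis
  proof eventually_elim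
    case (elim n)
    then have "v n * (A * s\<^sup>2 / 2 - \<eta>) \<le> ln (mgf n s)"
      "ln (mgf n s) \<le> v n * (A * s\<^sup>2 / 2 + \<eta>)"
      by (auto simp: dist_real_def abs_less_iff field_simps)
    then have "exp (v n * (A * s\<^sup>2 / 2 - \<eta>)) \<le> exp (ln (mgf n s))"
      "exp (ln (mgf n s)) \<le> exp (v n * (A * s\<^sup>2 / 2 + \<eta>))"
      by (auto simp only: exp_le_cancel_iff)
    then show ?case using mgf_pos[of n s] by simp
  qed
qed

text \<open>Two-sided Chernoff bound. If \<open>\<bar>z\<bar> \<ge> r\<close>, then \<open>z\<close>
  or \<open>- z\<close> is at least \<open>r\<close>, so one of the two normalised exponentials is
  at least 1 and their sum dominates the indicator. This treats both half-lines at once.\<close>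

lemma prob_le_mgf:
  assumes B: "B \<in> sets borel" and r: "\<And>z. z \<in> B \<Longrightarrow> r \<le> \<bar>z\<bar>" and s: "s \<ge> 0" and v: "v n > 0"
  shows "prob {\<omega> \<in> space Q. Z n \<omega> \<in> B} \<le> exp (- (v n * s * r)) * (mgf n s + mgf n (- s))"
proof -
  have E: "{\<omega> \<in> space Q. Z n \<omega> \<in> B} \<in> sets Q" using B by measurable
  have "prob {\<omega> \<in> space Q. Z n \<omega> \<in> B}
      = expectation (indicator {\<omega> \<in> space Q. Z n \<omega> \<in> B} :: _ \<Rightarrow> real)"
    using E by simp
  also have "\<dots> \<le> expectation
      (\<lambda>\<omega>. exp (- (v n * s * r)) * (exp (v n * s * Z n \<omega>) + exp (v n * (- s) * Z n \<omega>)))"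
  proof (rule integral_mono)
    fix \<omega> assume "\<omega> \<in> space Q"
    show "indicator {\<omega> \<in> space Q. Z n \<omega> \<in> B} \<omega>
      \<le> exp (- (v n * s * r)) * (exp (v n * s * Z n \<omega>) + exp (v n * (- s) * Z n \<omega>))"
    proof (cases "Z n \<omega> \<in> B")
      case True
      have vs: "v n * s \<ge> 0" using v s by simp
      have "r \<le> Z n \<omega> \<or> r \<le> - Z n \<omega>" using r[OF True] by linarith
      then have "v n * s * r \<le> v n * s * Z n \<omega> \<or> v n * s * r \<le> v n * s * (- Z n \<omega>)"
        using vs mult_left_mono by blast
      then have "1 \<le> exp (- (v n * s * r) + v n * s * Z n \<omega>)
          \<or> 1 \<le> exp (- (v n * s * r) + v n * (- s) * Z n \<omega>)"
        by auto
      then have "1 \<le> exp (- (v n * s * r) + v n * s * Z n \<omega>)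
          + exp (- (v n * s * r) + v n * (- s) * Z n \<omega>)"
        by (smt (verit) exp_gt_zero)
      then have "1 \<le> exp (- (v n * s * r)) * (exp (v n * s * Z n \<omega>) + exp (v n * (- s) * Z n \<omega>))"
        by (simp only: distrib_left exp_add)
      then show ?thesis by (auto simp: indicator_def)
    next
      case False
      then show ?thesis by (auto simp: indicator_def intro!: mult_nonneg_nonneg add_nonneg_nonneg)
    qed
  next
    show "integrable Q (indicator {\<omega> \<in> space Q. Z n \<omega> \<in> B} :: _ \<Rightarrow> real)"
      using E by (simp add: less_top[symmetric])
  qed (intro integrable_mult_right Bochner_Integration.integrable_add integrable_exp)
  also have "\<dots> = exp (- (v n * s * r)) * (mgf n s + mgf n (- s))"
    using integrable_exp[of "v n * s" n] integrable_exp[of "v n * (- s)" n] by simp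
  finally show ?thesis .
qed

text \<open>Outside the ball, \<open>e\<^bsup>vsz\<^esup>\<close> is dominated by the exponentials with the slopes \<open>s \<plusminus> \<epsilon>\<close>,
  normalised at the two end points. For \<open>s = t / A\<close> these have exponentially smaller mean, so
  no tilted measure is needed.\<close>

lemma mgf_le_prob:
  assumes B: "B \<in> sets borel" "ball t \<delta> \<subseteq> B" and v: "v n > 0" and \<epsilon>: "\<epsilon> \<ge> 0"
  shows "mgf n s \<le> exp (v n * (s * t + \<bar>s\<bar> * \<delta>)) * prob {\<omega> \<in> space Q. Z n \<omega> \<in> B}
      + exp (- (v n * (\<epsilon> * (t + \<delta>)))) * mgf n (s + \<epsilon>) + exp (v n * (\<epsilon> * (t - \<delta>))) * mgf n (s - \<epsilon>)"
proof -
  let ?E = "{\<omega> \<in> space Q. Z n \<omega> \<in> B}"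
  let ?c = "exp (v n * (s * t + \<bar>s\<bar> * \<delta>))"
  let ?u = "exp (- (v n * (\<epsilon> * (t + \<delta>))))" and ?l = "exp (v n * (\<epsilon> * (t - \<delta>)))"
  have E: "?E \<in> sets Q" using B(1) by measurable
  have int: "integrable Q (\<lambda>\<omega>. ?c * indicator ?E \<omega>)"
    "integrable Q (\<lambda>\<omega>. ?u * exp (v n * (s + \<epsilon>) * Z n \<omega>))"
    "integrable Q (\<lambda>\<omega>. ?l * exp (v n * (s - \<epsilon>) * Z n \<omega>))"
    using E integrable_exp by (auto simp: less_top[symmetric])
  have "mgf n s \<le> expectation (\<lambda>\<omega>. ?c * indicator ?E \<omega>
      + ?u * exp (v n * (s + \<epsilon>) * Z n \<omega>) + ?l * exp (v n * (s - \<epsilon>) * Z n \<omega>))"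
  proof (rule integral_mono)
    fix \<omega> assume \<omega>: "\<omega> \<in> space Q"
    let ?z = "Z n \<omega>"
    have up: "?u * exp (v n * (s + \<epsilon>) * ?z) = exp (v n * (s * ?z + \<epsilon> * (?z - t - \<delta>)))"
      and low: "?l * exp (v n * (s - \<epsilon>) * ?z) = exp (v n * (s * ?z + \<epsilon> * (t - \<delta> - ?z)))"
      by (simp_all add: exp_add[symmetric] algebra_simps)
    have le: "exp (v n * s * ?z) \<le> exp (v n * w)" if "s * ?z \<le> w" for w
      using that v by (simp add: mult.assoc)
    consider "?z \<in> ball t \<delta>" | "?z \<ge> t + \<delta>" | "?z \<le> t - \<delta>"
      unfolding mem_ball dist_real_def by linarith
    then show "exp (v n * s * ?z) \<le> ?c * indicator ?E \<omega>
        + ?u * exp (v n * (s + \<epsilon>) * ?z) + ?l * exp (v n * (s - \<epsilon>) * ?z)"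
    proof cases
      case 1
      have "s * (?z - t) \<le> \<bar>s\<bar> * \<bar>?z - t\<bar>" by (metis abs_ge_self abs_mult)
      also have "\<dots> \<le> \<bar>s\<bar> * \<delta>" using 1 by (intro mult_left_mono) (auto simp: dist_real_def)
      finally have "exp (v n * s * ?z) \<le> ?c" by (intro le) (simp add: algebra_simps)
      then show ?thesis using 1 B(2) \<omega> by (auto simp: subset_iff intro!: add_increasing2)
    next
      case 2
      have "exp (v n * s * ?z) \<le> exp (v n * (s * ?z + \<epsilon> * (?z - t - \<delta>)))"
        using 2 \<epsilon> by (intro le) simp
      then show ?thesis unfolding up low
        by (intro add_increasing2[OF less_imp_le[OF exp_gt_zero]] add_increasing) auto
    next
      case 3
      have "exp (v n * s * ?z) \<le> exp (v n * (s * ?z + \<epsilon> * (t - \<delta> - ?z)))"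
        using 3 \<epsilon> by (intro le) simp
      then show ?thesis unfolding up low
        by (intro add_increasing) auto
    qed
  qed (use int integrable_exp in auto)
  also have "\<dots> = ?c * prob ?E + ?u * mgf n (s + \<epsilon>) + ?l * mgf n (s - \<epsilon>)"
    using int E by simp
  finally show ?thesis .
qed

text \<open>The rate grows with \<open>\<bar>t\<bar>\<close>, so its infimum over the closure is
  attained at a point nearest to 0, and all of \<open>B\<close> lies in
  \<open>\<bar>z\<bar> \<ge> r\<close> for the distance \<open>r\<close> of that point. The
  two-sided Chernoff bound then suffices, whether \<open>B\<close> is bounded or not. The empty set
  has no nearest point and is treated first.\<close>

lemma limsup_le:
  assumes B: "B \<in> sets borel"
  shows "limsup (\<lambda>n. ereal (1 / v n) * elog (prob {\<omega> \<in> space Q. Z n \<omega> \<in> B}))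
    \<le> - (INF t\<in>closure B. ereal (t\<^sup>2 / (2 * A)))" (is "limsup ?L \<le> _")
proof (cases "B = {}")
  case True
  have "\<forall>\<^sub>F n in sequentially. v n > 0"
    using speed by (simp add: filterlim_at_top_dense)
  then have "\<forall>\<^sub>F n in sequentially. ?L n \<le> -\<infinity>"
    by eventually_elim (simp add: True elog_def)
  then show ?thesis
    using Limsup_bounded[of ?L "-\<infinity>" sequentially] by simp
next
  case False
  then obtain t where t: "t \<in> closure B" "\<And>z. z \<in> closure B \<Longrightarrow> dist 0 t \<le> dist 0 z"
    using distance_attains_inf[of "closure B" 0] by auto
  define r where "r = \<bar>t\<bar>"
  \<comment> \<open>The minimiser of \<open>A * s\<^sup>2 / 2 - s * r\<close>; the minimum is minus
    the Legendre transform of the quadratic limit at \<open>r\<close>.\<close>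
  define s where "s = r / A"
  have r: "r \<le> \<bar>z\<bar>" if "z \<in> B" for z
    using t(2)[of z] that closure_subset by (auto simp: r_def)
  have s: "s \<ge> 0" using A_pos by (simp add: s_def r_def)
  have rate: "A * s\<^sup>2 / 2 - s * r = - (t\<^sup>2 / (2 * A))"
    using A_pos by (simp add: s_def r_def field_simps power2_eq_square)
  have "limsup ?L \<le> ereal (- (t\<^sup>2 / (2 * A))) + ereal e" if e: "e > 0" for e
  proof -
    \<comment> \<open>Half of \<open>e\<close> pays for the error in the moments. The threshold
      \<open>2 * ln 2 / e\<close> makes \<open>exp (v n * (e / 2))\<close> at least 2, which absorbs
      the factor from adding two slopes.\<close>
    have "\<forall>\<^sub>F n in sequentially. v n > 0" "\<forall>\<^sub>F n in sequentially. v n \<ge> 2 * ln 2 / e"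
      using speed by (simp add: filterlim_at_top_dense, simp add: filterlim_at_top)
    moreover have "e / 2 > 0" using e by simp
    note eventually_mgf_bounds[OF this, of s] eventually_mgf_bounds[OF this, of "- s"]
    ultimately have "\<forall>\<^sub>F n in sequentially. ?L n \<le> ereal (- (t\<^sup>2 / (2 * A)) + e)"
    proof eventually_elim
      case (elim n)
      have "ln 2 \<le> v n * (e / 2)" using elim(2) e by (simp add: field_simps)
      then have two: "2 \<le> exp (v n * (e / 2))"
        by (metis exp_le_cancel_iff exp_ln zero_less_numeral)
      have "mgf n s + mgf n (- s) \<le> 2 * exp (v n * (A * s\<^sup>2 / 2 + e / 2))"
        using elim by simp
      also have "\<dots> \<le> exp (v n * (e / 2)) * exp (v n * (A * s\<^sup>2 / 2 + e / 2))"
        by (rule mult_right_mono[OF two]) simp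
      finally have "mgf n s + mgf n (- s) \<le> exp (v n * (e / 2)) * exp (v n * (A * s\<^sup>2 / 2 + e / 2))" .
      then have "exp (- (v n * s * r)) * (mgf n s + mgf n (- s))
          \<le> exp (- (v n * s * r)) * (exp (v n * (e / 2)) * exp (v n * (A * s\<^sup>2 / 2 + e / 2)))"
        by simp
      also have "\<dots> = exp (v n * (A * s\<^sup>2 / 2 - s * r + e))"
        by (simp add: exp_add[symmetric] algebra_simps)
      finally have "prob {\<omega> \<in> space Q. Z n \<omega> \<in> B} \<le> exp (v n * (- (t\<^sup>2 / (2 * A)) + e))"
        using prob_le_mgf[OF B r s, of n] elim by (simp add: rate)
      then show ?case using elim by (intro scaled_elog_le) auto
    qed
    then show ?thesis by (simp add: Limsup_bounded)
  qed
  then have "limsup ?L \<le> ereal (- (t\<^sup>2 / (2 * A)))"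
    by (rule ereal_le_epsilon2)
  also have "\<dots> \<le> - (INF t\<in>closure B. ereal (t\<^sup>2 / (2 * A)))"
    using INF_lower[OF t(1), of "\<lambda>t. ereal (t\<^sup>2 / (2 * A))"]
    by (simp add: ereal_uminus_le_reorder flip: uminus_ereal.simps)
  finally show ?thesis .
qed

text \<open>Each interior point \<open>t\<close> is tested separately, with the slope at which the
  exponential moment comes mainly from values of \<open>Z n\<close> near \<open>t\<close>. The tails
  lose \<open>\<delta>\<^sup>2 / (2 * A)\<close> in the exponent, so the ball carries the moment;
  dividing by the largest exponential on the ball bounds the probability from below. For an empty
  interior the infimum is \<open>\<infinity>\<close> and the bound is vacuous.\<close>

lemma liminf_ge:
  assumes B: "B \<in> sets borel"
  shows "- (INF t\<in>interior B. ereal (t\<^sup>2 / (2 * A)))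
    \<le> liminf (\<lambda>n. ereal (1 / v n) * elog (prob {\<omega> \<in> space Q. Z n \<omega> \<in> B}))" (is "_ \<le> liminf ?L")
proof -
  have "- liminf ?L \<le> ereal (t\<^sup>2 / (2 * A))" if "t \<in> interior B" for t
  proof -
    define s where "s = t / A"
    have rate: "A * s\<^sup>2 / 2 - s * t = - (t\<^sup>2 / (2 * A))"
      using A_pos by (simp add: s_def field_simps power2_eq_square)
    have "ereal (- (t\<^sup>2 / (2 * A))) \<le> liminf ?L + ereal e" if e: "e > 0" for e
    proof -
      obtain \<rho> where \<rho>: "\<rho> > 0" "ball t \<rho> \<subseteq> B"
        using \<open>t \<in> interior B\<close> by (auto simp: mem_interior)
      \<comment> \<open>Keeps the variation \<open>\<bar>s\<bar> * \<delta>\<close> of the exponent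
        within \<open>e / 2\<close>; the added 1 covers \<open>s = 0\<close>.\<close>
      define \<delta> where "\<delta> = min \<rho> (e / (2 * (\<bar>s\<bar> + 1)))"
      \<comment> \<open>Two demands: the final loss \<open>3 * \<eta>\<close> must fit into the
        other \<open>e / 2\<close>, and the tail exponent
        \<open>K - \<delta>\<^sup>2 / (2 * A) + \<eta>\<close> must stay below
        \<open>K - 3 * \<eta>\<close>.\<close>
      define \<eta> where "\<eta> = min (e / 6) (\<delta>\<^sup>2 / (8 * A))"
      have \<delta>: "\<delta> > 0" "ball t \<delta> \<subseteq> B" using \<rho> e by (auto simp: \<delta>_def)
      have "\<bar>s\<bar> * \<delta> \<le> (\<bar>s\<bar> + 1) * (e / (2 * (\<bar>s\<bar> + 1)))"
        using \<delta> by (intro mult_mono) (auto simp: \<delta>_def)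
      also have "\<dots> = e / 2" by (simp add: field_simps)
      finally have s\<delta>: "\<bar>s\<bar> * \<delta> \<le> e / 2" .
      have \<eta>: "\<eta> > 0" "3 * \<eta> \<le> e / 2" "4 * \<eta> \<le> \<delta>\<^sup>2 / (2 * A)"
        using e \<delta> A_pos by (auto simp: \<eta>_def min_def field_simps)
      \<comment> \<open>The optimal change of slope for both tails: it moves the slope from
        \<open>t / A\<close> to \<open>(t + \<delta>) / A\<close> or
        \<open>(t - \<delta>) / A\<close>, the slopes that belong to the end points of the
        ball.\<close>
      define \<epsilon> where "\<epsilon> = \<delta> / A"
      define K where "K = A * s\<^sup>2 / 2"
      have up: "A * (s + \<epsilon>)\<^sup>2 / 2 - \<epsilon> * (t + \<delta>) = K - \<delta>\<^sup>2 / (2 * A)"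
        and low: "A * (s - \<epsilon>)\<^sup>2 / 2 + \<epsilon> * (t - \<delta>) = K - \<delta>\<^sup>2 / (2 * A)"
        using A_pos by (auto simp: \<epsilon>_def s_def K_def field_simps power2_eq_square)
      have "\<forall>\<^sub>F n in sequentially. v n > 0" "\<forall>\<^sub>F n in sequentially. v n \<ge> ln 2 / \<eta>"
        using speed by (simp add: filterlim_at_top_dense, simp add: filterlim_at_top)
      moreover note eventually_mgf_bounds[OF \<eta>(1), of s]
        eventually_mgf_bounds[OF \<eta>(1), of "s + \<epsilon>"] eventually_mgf_bounds[OF \<eta>(1), of "s - \<epsilon>"]
      ultimately have "\<forall>\<^sub>F n in sequentially. ereal (- (t\<^sup>2 / (2 * A)) - e) \<le> ?L n"
      proof eventually_elim
        case (elim n)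
        define p where "p = prob {\<omega> \<in> space Q. Z n \<omega> \<in> B}"
        define u where "u = exp (v n * \<eta>)"
        \<comment> \<open>A common upper bound for the two tail terms. The full moment is at least
          \<open>w * (u * u)\<close>, hence at least \<open>4 * w\<close>, so that removing both
          tails leaves more than \<open>w\<close> for the term with the probability of
          \<open>B\<close>.\<close>
        define w where "w = exp (v n * (K - 3 * \<eta>))"
        have "ln 2 \<le> v n * \<eta>" using elim \<eta> by (simp add: field_simps)
        then have u: "u \<ge> 2" unfolding u_def by (metis exp_le_cancel_iff exp_ln zero_less_numeral)
        have w: "w > 0" by (simp add: w_def)
        have tail: "exp (v n * x) * exp (v n * (y + \<eta>)) \<le> w"
          if "y + x = K - \<delta>\<^sup>2 / (2 * A)" for x y
        proof -
          have "x + (y + \<eta>) \<le> K - 3 * \<eta>" using that \<eta> by linarith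
          then have "v n * (x + (y + \<eta>)) \<le> v n * (K - 3 * \<eta>)"
            using elim by (intro mult_left_mono) auto
          then show ?thesis by (simp add: w_def exp_add[symmetric] algebra_simps)
        qed
        have "exp (- (v n * (\<epsilon> * (t + \<delta>)))) * mgf n (s + \<epsilon>)
            \<le> exp (v n * (- (\<epsilon> * (t + \<delta>)))) * exp (v n * (A * (s + \<epsilon>)\<^sup>2 / 2 + \<eta>))"
          using elim by simp
        also have "\<dots> \<le> w" using up by (intro tail) simp
        finally have 1: "exp (- (v n * (\<epsilon> * (t + \<delta>)))) * mgf n (s + \<epsilon>) \<le> w" .
        have "exp (v n * (\<epsilon> * (t - \<delta>))) * mgf n (s - \<epsilon>)
            \<le> exp (v n * (\<epsilon> * (t - \<delta>))) * exp (v n * (A * (s - \<epsilon>)\<^sup>2 / 2 + \<eta>))"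
          using elim by simp
        also have "\<dots> \<le> w" using low by (intro tail) simp
        finally have 2: "exp (v n * (\<epsilon> * (t - \<delta>))) * mgf n (s - \<epsilon>) \<le> w" .
        have "w * (u * u) = exp (v n * (K - \<eta>))"
          by (simp add: u_def w_def exp_add[symmetric] algebra_simps)
        moreover have "w * (2 * 2) \<le> w * (u * u)"
          using u w by (intro mult_left_mono mult_mono) auto
        ultimately have "w \<le> mgf n s - 2 * w" using elim w by (simp add: K_def)
        also have "\<dots> \<le> exp (v n * (s * t + \<bar>s\<bar> * \<delta>)) * p"
          using mgf_le_prob[OF B \<delta>(2), of n \<epsilon> s] 1 2 elim \<delta> A_pos
          by (simp add: p_def \<epsilon>_def)
        finally have "exp (- (v n * (s * t + \<bar>s\<bar> * \<delta>))) * w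
            \<le> exp (- (v n * (s * t + \<bar>s\<bar> * \<delta>))) * (exp (v n * (s * t + \<bar>s\<bar> * \<delta>)) * p)"
          by simp
        then have p: "exp (v n * (K - s * t - 3 * \<eta> - \<bar>s\<bar> * \<delta>)) \<le> p"
          unfolding mult.assoc[symmetric] by (simp add: w_def exp_add[symmetric] algebra_simps)
        have "- (t\<^sup>2 / (2 * A)) - e \<le> K - s * t - 3 * \<eta> - \<bar>s\<bar> * \<delta>"
          using \<eta>(2) s\<delta> rate K_def by linarith
        then have "exp (v n * (- (t\<^sup>2 / (2 * A)) - e)) \<le> p"
          using elim by (intro order_trans[OF _ p]) simp
        then show ?case using elim unfolding p_def by (intro scaled_elog_ge) auto
      qed
      then have "ereal (- (t\<^sup>2 / (2 * A)) - e) \<le> liminf ?L" by (rule Liminf_bounded)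
      then show ?thesis by (cases "liminf ?L") (auto simp: algebra_simps)
    qed
    then have "ereal (- (t\<^sup>2 / (2 * A))) \<le> liminf ?L" by (rule ereal_le_epsilon2)
    then show ?thesis by (simp add: ereal_uminus_le_reorder)
  qed
  then have "- liminf ?L \<le> (INF t\<in>interior B. ereal (t\<^sup>2 / (2 * A)))" by (rule INF_greatest)
  then show ?thesis by (simp add: ereal_uminus_le_reorder)
qed

theorem deviation_principle: "deviation_principle Q Z v (\<lambda>t. ereal (t\<^sup>2 / (2 * A)))"
  unfolding deviation_principle_def Let_def
  using limsup_le liminf_ge by (auto intro: Liminf_le_Limsup)

end

section \<open>Log-Laplace transform of a single centred step\<close>

lemma abs_exp_minus_quadratic_le:
  fixes y :: real
  assumes "\<bar>y\<bar> \<le> 1"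
  shows "\<bar>exp y - (1 + y + y\<^sup>2 / 2)\<bar> \<le> \<bar>y\<bar> ^ 3"
proof -
  obtain t where t: "\<bar>t\<bar> \<le> \<bar>y\<bar>" "exp y = (\<Sum>m<3. y ^ m / fact m) + exp t / fact 3 * y ^ 3"
    using Maclaurin_exp_le by blast
  \<comment> \<open>The Lagrange remainder has the coefficient \<open>exp t / fact 3\<close>, which
    is at most 1 because \<open>exp 1 \<le> 3\<close>.\<close>
  have "exp t \<le> exp 1" using t assms by simp
  then have "exp t \<le> 6" using exp_le by linarith
  moreover have "exp y - (1 + y + y\<^sup>2 / 2) = exp t / 6 * y ^ 3"
    using t(2) by (simp add: eval_nat_numeral)
  ultimately show ?thesis
    using mult_right_mono[of "exp t / 6" 1 "\<bar>y\<bar> ^ 3"] by (simp only: abs_mult power_abs) simp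
qed

text \<open>Centring removes the linear term, and the quadratic one is half the variance
  \<open>4 * p * (1 - p)\<close> times \<open>l\<^sup>2\<close>. Of the constant 10, a part 8 is the
  cubic remainder of the exponential at arguments up to \<open>2 * \<bar>l\<bar>\<close>, and a part
  2 comes from replacing \<open>ln (1 + u)\<close> by \<open>u\<close>.\<close>

lemma ln_centered_bernoulli_mgf:
  fixes p l :: real
  assumes p: "0 \<le> p" "p \<le> 1" and l: "\<bar>l\<bar> \<le> 1 / 16"
  shows "\<bar>ln (p * exp (l * (2 * (1 - p))) + (1 - p) * exp (l * (- 2 * p))) - 2 * l\<^sup>2 * (p * (1 - p))\<bar>
    \<le> 10 * \<bar>l\<bar> ^ 3"
proof -
  define y where "y = l * (2 * (1 - p))"
  define z where "z = l * (- 2 * p)"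
  define m where "m = p * exp y + (1 - p) * exp z"
  define u where "u = m - 1"
  have y: "\<bar>y\<bar> \<le> 2 * \<bar>l\<bar>" and z: "\<bar>z\<bar> \<le> 2 * \<bar>l\<bar>"
    using p mult_left_mono[of "\<bar>2 * (1 - p)\<bar>" 2 "\<bar>l\<bar>"] mult_left_mono[of "\<bar>- 2 * p\<bar>" 2 "\<bar>l\<bar>"]
    unfolding y_def z_def abs_mult[of l] by auto
  have cub: "\<bar>exp q - (1 + q + q\<^sup>2 / 2)\<bar> \<le> 8 * \<bar>l\<bar> ^ 3" if "\<bar>q\<bar> \<le> 2 * \<bar>l\<bar>" for q
  proof -
    have "\<bar>exp q - (1 + q + q\<^sup>2 / 2)\<bar> \<le> \<bar>q\<bar> ^ 3"
      using that l by (intro abs_exp_minus_quadratic_le) linarith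
    also have "\<dots> \<le> (2 * \<bar>l\<bar>) ^ 3" using that by (intro power_mono) auto
    finally show ?thesis by (simp add: power_mult_distrib)
  qed
  \<comment> \<open>Uses \<open>p * y + (1 - p) * z = 0\<close> and \<open>p * y\<^sup>2 + (1 - p) *
    z\<^sup>2 = 4 * l\<^sup>2 * (p * (1 - p))\<close>.\<close>
  have id: "u - 2 * l\<^sup>2 * (p * (1 - p))
      = p * (exp y - (1 + y + y\<^sup>2 / 2)) + (1 - p) * (exp z - (1 + z + z\<^sup>2 / 2))"
    unfolding u_def m_def by (simp add: y_def z_def field_simps power2_eq_square)
  have "\<bar>u - 2 * l\<^sup>2 * (p * (1 - p))\<bar>
      \<le> p * \<bar>exp y - (1 + y + y\<^sup>2 / 2)\<bar> + (1 - p) * \<bar>exp z - (1 + z + z\<^sup>2 / 2)\<bar>"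
    unfolding id using p by (intro order_trans[OF abs_triangle_ineq]) (simp add: abs_mult)
  also have "\<dots> \<le> p * (8 * \<bar>l\<bar> ^ 3) + (1 - p) * (8 * \<bar>l\<bar> ^ 3)"
    using p y z by (intro add_mono mult_left_mono cub) auto
  finally have u: "\<bar>u - 2 * l\<^sup>2 * (p * (1 - p))\<bar> \<le> 8 * \<bar>l\<bar> ^ 3" by (simp add: algebra_simps)
  \<comment> \<open>Here the bound 1/16 enters: it turns the remainder
    \<open>8 * \<bar>l\<bar> ^ 3\<close> into at most \<open>l\<^sup>2 / 2\<close>. The main term is
    also at most \<open>l\<^sup>2 / 2\<close>, whence
    \<open>\<bar>u\<bar> \<le> l\<^sup>2\<close>.\<close>
  have cube: "\<bar>l\<bar> ^ 3 \<le> l\<^sup>2 / 16"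
  proof -
    have "\<bar>l\<bar> ^ 3 = \<bar>l\<bar> * l\<^sup>2" by (simp add: power3_eq_cube power2_eq_square)
    also have "\<dots> \<le> 1 / 16 * l\<^sup>2" using l by (intro mult_right_mono) auto
    finally show ?thesis by simp
  qed
  have "p * (1 - p) \<le> 1 / 4" using zero_le_power2[of "2 * p - 1"] by (simp add: power2_eq_square algebra_simps)
  then have "2 * l\<^sup>2 * (p * (1 - p)) \<le> 2 * l\<^sup>2 * (1 / 4)" by (intro mult_left_mono) auto
  moreover have "0 \<le> 2 * l\<^sup>2 * (p * (1 - p))" using p by simp
  ultimately have ul: "\<bar>u\<bar> \<le> l\<^sup>2" using u cube by linarith
  have l2: "l\<^sup>2 \<le> 1 / 256"
    using power_mono[OF l, of 2] by (simp add: power2_eq_square)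
  have "\<bar>ln (1 + u) - u\<bar> \<le> 2 * u\<^sup>2"
    using ul l2 by (intro abs_ln_one_plus_x_minus_x_bound) linarith
  also have "u\<^sup>2 \<le> (l\<^sup>2)\<^sup>2" using ul by (metis abs_ge_zero power2_abs power_mono)
  also have "(l\<^sup>2)\<^sup>2 = \<bar>l\<bar> * \<bar>l\<bar> ^ 3" by (simp add: power2_eq_square power3_eq_cube)
  also have "\<dots> \<le> 1 * \<bar>l\<bar> ^ 3" using l by (intro mult_right_mono) auto
  finally have "\<bar>ln (1 + u) - u\<bar> \<le> 2 * \<bar>l\<bar> ^ 3" by simp
  then have "\<bar>ln m - 2 * l\<^sup>2 * (p * (1 - p))\<bar> \<le> 10 * \<bar>l\<bar> ^ 3"
    using u unfolding u_def by simp
  then show ?thesis by (simp add: m_def y_def z_def)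
qed

section \<open>Exponential moments of the walk under a quenched measure\<close>

context dynamic_random_walk
begin

lemma iterate_in_space: "x \<in> space M \<Longrightarrow> (T ^^ k) x \<in> space M"
  using measurable_T by (induction k) (auto dest: measurable_space)

lemma f_iterate_range:
  assumes "x \<in> space M"
  shows "0 \<le> f ((T ^^ k) x)" "f ((T ^^ k) x) \<le> 1"
  using f_range[OF iterate_in_space[OF assms]] by auto

lemma random_variable_step:
  assumes "x \<in> space M" "i \<ge> 1"
  shows "X i \<in> borel_measurable (P x)"
  using indep_steps[OF assms(1)] assms(2)
  by (auto simp: prob_space.indep_vars_def[OF prob_space_P[OF assms(1)]])

text \<open>The probabilities of the values 1 and -1 add up to 1, so the step takes no other value
  almost surely, and the exponential agrees almost everywhere with a combination of two
  indicators.\<close>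

lemma has_bochner_integral_exp_centered_step:
  assumes x: "x \<in> space M" and i: "i \<ge> 1"
  defines "p \<equiv> f ((T ^^ i) x)"
  shows "has_bochner_integral (P x) (\<lambda>\<omega>. exp (l * centered_step T f X x i \<omega>))
    (p * exp (l * (2 * (1 - p))) + (1 - p) * exp (l * (- 2 * p)))"
proof -
  interpret Q: prob_space "P x" by (rule prob_space_P[OF x])
  note [measurable] = random_variable_step[OF x i]
  let ?U = "{\<omega> \<in> space (P x). X i \<omega> = 1}" and ?D = "{\<omega> \<in> space (P x). X i \<omega> = - 1}"
  let ?g = "\<lambda>\<omega>. indicator ?U \<omega> * exp (l * (2 * (1 - p))) + indicator ?D \<omega> * exp (l * (- 2 * p)) :: real"
  have up: "Q.prob ?U = p" and down: "Q.prob ?D = 1 - p"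
    using prob_step_up[OF x i] prob_step_down[OF x i] by (simp_all add: p_def)
  have [measurable]: "?U \<in> sets (P x)" "?D \<in> sets (P x)" by measurable
  have "Q.prob (?U \<union> ?D) = Q.prob ?U + Q.prob ?D"
    by (rule Q.finite_measure_Union) auto
  then have "AE \<omega> in P x. \<omega> \<in> ?U \<union> ?D"
    by (intro Q.AE_prob_1) (simp add: up down)
  then have ae: "AE \<omega> in P x. ?g \<omega> = exp (l * centered_step T f X x i \<omega>)"
    by eventually_elim (auto simp: centered_step_def p_def algebra_simps)
  have "has_bochner_integral (P x) ?g (Q.prob ?U * exp (l * (2 * (1 - p))) + Q.prob ?D * exp (l * (- 2 * p)))"
    by (intro has_bochner_integral_add has_bochner_integral_mult_left has_bochner_integral_real_indicator)
       (auto simp: less_top[symmetric])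
  then have "has_bochner_integral (P x) ?g (p * exp (l * (2 * (1 - p))) + (1 - p) * exp (l * (- 2 * p)))"
    unfolding up down .
  moreover have "(\<lambda>\<omega>. exp (l * centered_step T f X x i \<omega>)) \<in> borel_measurable (P x)"
    unfolding centered_step_def by measurable
  ultimately show ?thesis
    using ae by (subst has_bochner_integral_cong_AE[symmetric, where f = ?g])
      (auto dest: has_bochner_integral_integrable)
qed

text \<open>For fixed \<open>x\<close> the centring is deterministic, so the factors are functions
  of the independent steps.\<close>

lemma exp_centered_walk:
  assumes x: "x \<in> space M"
  shows "integrable (P x) (\<lambda>\<omega>. exp (l * centered_walk T f X x n \<omega>))" (is ?int)
    and "(\<integral>\<omega>. exp (l * centered_walk T f X x n \<omega>) \<partial>P x)
      = (\<Prod>i=1..n. \<integral>\<omega>. exp (l * centered_step T f X x i \<omega>) \<partial>P x)" (is ?eq)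
proof -
  interpret Q: prob_space "P x" by (rule prob_space_P[OF x])
  have "Q.indep_vars (\<lambda>_. borel) X {1..n}"
    by (rule Q.indep_vars_subset[OF indep_steps[OF x]]) auto
  then have ind: "Q.indep_vars (\<lambda>_. borel) (\<lambda>i \<omega>. exp (l * centered_step T f X x i \<omega>)) {1..n}"
    unfolding centered_step_def
    by (rule Q.indep_vars_compose2[where Y = "\<lambda>i y. exp (l * (y - (2 * f ((T ^^ i) x) - 1)))"]) measurable
  have int: "integrable (P x) (\<lambda>\<omega>. exp (l * centered_step T f X x i \<omega>))" if "i \<in> {1..n}" for i
    using has_bochner_integral_exp_centered_step[OF x] that by (auto dest: integrable.intros)
  have eq: "exp (l * centered_walk T f X x n \<omega>) = (\<Prod>i=1..n. exp (l * centered_step T f X x i \<omega>))" for \<omega>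
    by (simp add: centered_walk_def sum_distrib_left exp_sum)
  show ?int ?eq
    unfolding eq using Q.indep_vars_integrable[OF _ ind int] Q.indep_vars_lebesgue_integral[OF _ ind int] by auto
qed

text \<open>The one-step error is uniform in the success probability, so the errors add up to
  \<open>n\<close> times a cubic term, whatever the orbit of \<open>x\<close>; the orbit enters only
  through the Birkhoff sum.\<close>

lemma ln_mgf_centered_walk:
  assumes x: "x \<in> space M" and l: "\<bar>l\<bar> \<le> 1 / 16"
  shows "\<bar>ln (\<integral>\<omega>. exp (l * centered_walk T f X x n \<omega>) \<partial>P x)
      - 2 * l\<^sup>2 * (\<Sum>i=1..n. f ((T ^^ i) x) * (1 - f ((T ^^ i) x)))\<bar> \<le> 10 * real n * \<bar>l\<bar> ^ 3"
proof -
  interpret Q: prob_space "P x" by (rule prob_space_P[OF x])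
  let ?m = "\<lambda>i. \<integral>\<omega>. exp (l * centered_step T f X x i \<omega>) \<partial>P x"
  have step: "0 < ?m i" "\<bar>ln (?m i) - 2 * l\<^sup>2 * (f ((T ^^ i) x) * (1 - f ((T ^^ i) x)))\<bar> \<le> 10 * \<bar>l\<bar> ^ 3"
    if "i \<in> {1..n}" for i
  proof -
    have h: "has_bochner_integral (P x) (\<lambda>\<omega>. exp (l * centered_step T f X x i \<omega>))
      (f ((T ^^ i) x) * exp (l * (2 * (1 - f ((T ^^ i) x))))
        + (1 - f ((T ^^ i) x)) * exp (l * (- 2 * f ((T ^^ i) x))))"
      using that by (intro has_bochner_integral_exp_centered_step x) auto
    then show "0 < ?m i" by (intro Q.expectation_greater) (auto intro: integrable.intros)
    show "\<bar>ln (?m i) - 2 * l\<^sup>2 * (f ((T ^^ i) x) * (1 - f ((T ^^ i) x)))\<bar> \<le> 10 * \<bar>l\<bar> ^ 3"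
      unfolding has_bochner_integral_integral_eq[OF h]
      by (rule ln_centered_bernoulli_mgf[OF f_iterate_range[OF x] l])
  qed
  have "ln (\<integral>\<omega>. exp (l * centered_walk T f X x n \<omega>) \<partial>P x) = (\<Sum>i=1..n. ln (?m i))"
    unfolding exp_centered_walk(2)[OF x] by (rule ln_prod) (simp, rule less_imp_neq[THEN not_sym], rule step(1))
  then have "\<bar>ln (\<integral>\<omega>. exp (l * centered_walk T f X x n \<omega>) \<partial>P x)
      - 2 * l\<^sup>2 * (\<Sum>i=1..n. f ((T ^^ i) x) * (1 - f ((T ^^ i) x)))\<bar>
    = \<bar>\<Sum>i=1..n. ln (?m i) - 2 * l\<^sup>2 * (f ((T ^^ i) x) * (1 - f ((T ^^ i) x)))\<bar>"
    by (simp add: sum_subtractf sum_distrib_left)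
  also have "\<dots> \<le> (\<Sum>i=1..n. 10 * \<bar>l\<bar> ^ 3)"
    by (rule order_trans[OF sum_abs sum_mono]) (use step(2) in auto)
  finally show ?thesis by simp
qed

end

section \<open>Birkhoff averages and the moderate deviation principle\<close>

lemma class_C_1_average:
  assumes h: "h \<in> class_C 1 M T" and x: "x \<in> space M"
  shows "(\<lambda>n. (\<Sum>k=1..n. h ((T ^^ k) x)) / real n) \<longlonglongrightarrow> integral\<^sup>L M h"
proof -
  have "(\<lambda>n. \<bar>\<Sum>k=1..n. (h ((T ^^ k) x) - integral\<^sup>L M h)\<bar>) \<in> o(\<lambda>n. real n powr 1)"
    using h x by (auto simp: class_C_def)
  then have "(\<lambda>n. \<Sum>k=1..n. (h ((T ^^ k) x) - integral\<^sup>L M h)) \<in> o(\<lambda>n. real n)" by simp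
  then have "(\<lambda>n. (\<Sum>k=1..n. (h ((T ^^ k) x) - integral\<^sup>L M h)) / real n) \<longlonglongrightarrow> 0"
    by (rule smalloD_tendsto)
  \<comment> \<open>Only eventually: at \<open>n = 0\<close> division by zero makes the left side 0,
    while the right side is minus the integral.\<close>
  moreover have "\<forall>\<^sub>F n in sequentially. (\<Sum>k=1..n. (h ((T ^^ k) x) - integral\<^sup>L M h)) / real n
      = (\<Sum>k=1..n. h ((T ^^ k) x)) / real n - integral\<^sup>L M h"
    using eventually_gt_at_top[of 0] by eventually_elim (simp add: sum_subtractf field_simps)
  ultimately have "(\<lambda>n. (\<Sum>k=1..n. h ((T ^^ k) x)) / real n - integral\<^sup>L M h) \<longlonglongrightarrow> 0"
    by (rule Lim_transform_eventually)
  then show ?thesis by (rule LIM_zero_cancel)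
qed

theorem theorem1p1:
  fixes M :: "'e measure" and T :: "'e \<Rightarrow> 'e" and f :: "'e \<Rightarrow> real"
    and W :: "'w measure" and P :: "'e \<Rightarrow> 'w measure" and X :: "nat \<Rightarrow> 'w \<Rightarrow> real"
    and A :: real and a :: "nat \<Rightarrow> real"
  assumes walk: "dynamic_random_walk M T f W P X"
    and class_1: "(\<lambda>x. f x * (1 - f x)) \<in> class_C 1 M T"
    and A_def: "A = (\<integral>x. 4 * f x * (1 - f x) \<partial>M)"
    and A_pos: "A > 0"
    and a_pos: "\<And>n. n \<ge> 1 \<Longrightarrow> a n > 0"
    and a_mono: "mono_on {1..} a"
    and a_sqrt_mono: "mono_on {1..} (\<lambda>n. a n / sqrt (real n))"
    and a_sqrt_lim: "filterlim (\<lambda>n. a n / sqrt (real n)) at_top sequentially"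
    and a_lin_antimono: "antimono_on {1..} (\<lambda>n. a n / real n)"
    and a_lin_lim: "(\<lambda>n. a n / real n) \<longlonglongrightarrow> 0"
  shows "\<forall>x\<in>space M. deviation_principle (P x)
           (\<lambda>n \<omega>. centered_walk T f X x n \<omega> / a n)
           (\<lambda>n. (a n)\<^sup>2 / real n)
           (\<lambda>t. ereal (t\<^sup>2 / (2 * A)))"
proof
  fix x assume x: "x \<in> space M"
  interpret dynamic_random_walk M T f W P X by (rule walk)
  interpret Q: prob_space "P x" by (rule prob_space_P[OF x])
  define g where "g = (\<lambda>n. (\<Sum>k=1..n. f ((T ^^ k) x) * (1 - f ((T ^^ k) x))) / real n)"
  let ?Z = "\<lambda>n \<omega>. centered_walk T f X x n \<omega> / a n"
  let ?v = "\<lambda>n. (a n)\<^sup>2 / real n"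
  have "A = 4 * (\<integral>x. f x * (1 - f x) \<partial>M)" by (simp add: A_def mult.assoc)
  then have g: "g \<longlonglongrightarrow> A / 4"
    using class_C_1_average[OF class_1 x] by (simp add: g_def)
  have "quadratic_mgf (P x) ?Z ?v A"
  proof
    show "A > 0" by (rule A_pos)
    show "?Z n \<in> borel_measurable (P x)" for n
    proof -
      have "(\<lambda>\<omega>. centered_step T f X x i \<omega>) \<in> borel_measurable (P x)" if "i \<in> {1..n}" for i
        unfolding centered_step_def using that random_variable_step[OF x, of i] by simp
      then show ?thesis unfolding centered_walk_def by (intro borel_measurable_divide borel_measurable_sum) auto
    qed
    show "integrable (P x) (\<lambda>\<omega>. exp (s * ?Z n \<omega>))" for n s
      using exp_centered_walk(1)[OF x, of "s / a n" n] by simp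
    \<comment> \<open>The speed is the square of \<open>a n / sqrt (real n)\<close>.\<close>
    have "filterlim (\<lambda>n. (a n / sqrt (real n)) * (a n / sqrt (real n))) at_top sequentially"
      by (intro filterlim_at_top_mult_at_top a_sqrt_lim)
    then show "filterlim ?v at_top sequentially" by (simp add: power2_eq_square)
    fix s
    have "(\<lambda>n. 2 * s\<^sup>2 * g n) \<longlonglongrightarrow> 2 * s\<^sup>2 * (A / 4)" by (intro tendsto_intros g)
    moreover have "(\<lambda>n. ln (\<integral>\<omega>. exp (?v n * s * ?Z n \<omega>) \<partial>P x) / ?v n - 2 * s\<^sup>2 * g n) \<longlonglongrightarrow> 0"
    proof (rule Lim_null_comparison)
      show "(\<lambda>n. 10 * \<bar>s\<bar> ^ 3 * (a n / real n)) \<longlonglongrightarrow> 0"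
        by (intro tendsto_mult_right_zero a_lin_lim)
      \<comment> \<open>The slope acting on the unscaled walk tends to 0, so it eventually enters
        the range where the one-step expansion holds.\<close>
      have "(\<lambda>n. \<bar>s * (a n / real n)\<bar>) \<longlonglongrightarrow> 0"
        by (intro tendsto_rabs_zero tendsto_mult_right_zero a_lin_lim)
      then have "\<forall>\<^sub>F n in sequentially. \<bar>s * (a n / real n)\<bar> < 1 / 16"
        by (rule order_tendstoD) simp
      with eventually_ge_at_top[of 1]
      show "\<forall>\<^sub>F n in sequentially. norm (ln (\<integral>\<omega>. exp (?v n * s * ?Z n \<omega>) \<partial>P x) / ?v n - 2 * s\<^sup>2 * g n)
          \<le> 10 * \<bar>s\<bar> ^ 3 * (a n / real n)"
      proof eventually_elim
        case (elim n)
        \<comment> \<open>With this slope, \<open>2 * l\<^sup>2 * S\<close> divided by the speed is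
          exactly \<open>2 * s\<^sup>2 * g n\<close>, and the cubic error
          \<open>10 * real n * \<bar>l\<bar> ^ 3\<close> becomes
          \<open>10 * \<bar>s\<bar> ^ 3 * (a n / real n)\<close>.\<close>
        define l where "l = s * (a n / real n)"
        define S where "S = (\<Sum>i=1..n. f ((T ^^ i) x) * (1 - f ((T ^^ i) x)))"
        have n: "real n > 0" and an: "a n > 0" using elim a_pos by auto
        have l: "?v n * s * ?Z n \<omega> = l * centered_walk T f X x n \<omega>" for \<omega>
          using n an by (simp add: l_def field_simps power2_eq_square)
        have "ln (\<integral>\<omega>. exp (?v n * s * ?Z n \<omega>) \<partial>P x) / ?v n - 2 * s\<^sup>2 * g n
            = (ln (\<integral>\<omega>. exp (l * centered_walk T f X x n \<omega>) \<partial>P x) - 2 * l\<^sup>2 * S) / ?v n"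
          unfolding l using n an by (simp add: l_def g_def S_def field_simps power2_eq_square)
        then have "norm (ln (\<integral>\<omega>. exp (?v n * s * ?Z n \<omega>) \<partial>P x) / ?v n - 2 * s\<^sup>2 * g n)
            = \<bar>ln (\<integral>\<omega>. exp (l * centered_walk T f X x n \<omega>) \<partial>P x) - 2 * l\<^sup>2 * S\<bar> / ?v n"
          by (simp only: real_norm_def abs_divide) simp
        also have "\<dots> \<le> 10 * real n * \<bar>l\<bar> ^ 3 / ?v n"
          using ln_mgf_centered_walk[OF x, of l n] elim
          by (intro divide_right_mono) (simp_all add: l_def S_def)
        also have "\<dots> = 10 * \<bar>s\<bar> ^ 3 * (a n / real n)"
          using n an by (simp add: l_def abs_mult power2_eq_square power3_eq_cube field_simps)
        finally show ?case .
      qed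
    qed
    ultimately have "(\<lambda>n. 2 * s\<^sup>2 * g n + (ln (\<integral>\<omega>. exp (?v n * s * ?Z n \<omega>) \<partial>P x) / ?v n - 2 * s\<^sup>2 * g n))
        \<longlonglongrightarrow> 2 * s\<^sup>2 * (A / 4) + 0"
      by (rule tendsto_add)
    then show "(\<lambda>n. ln (\<integral>\<omega>. exp (?v n * s * ?Z n \<omega>) \<partial>P x) / ?v n) \<longlonglongrightarrow> A * s\<^sup>2 / 2"
      by (simp add: mult.commute)
  qed
  then show "deviation_principle (P x) ?Z ?v (\<lambda>t. ereal (t\<^sup>2 / (2 * A)))"
    by (rule quadratic_mgf.deviation_principle)
qed

end
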